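(* For a subset $\mathbb S$ of the positive integers define, for $|q|<1$, \[F_{\mathbb S}(q):=\sum_{\substack{\lambda\ne\emptyset\\ \mathrm{sm}(\lambda)\in\mathbb S}}\mu^*_{\mathcal P}(\lambda)q^{|\lambda|},\] the sum over nonempty integer partitions whose smallest part $\mathrm{sm}(\lambda)$ lies in $\mathbb S$. For integers $k,N\ge2$ let $\mathbb S^{(k)}_{\mathrm{fr}}(N):=\{n\ge1: p^k\nmid n\text{ for every prime }p\le N\}$. Then \[\lim_{q\to1}F_{\mathbb S^{(k)}_{\mathrm{fr}}(N)}(q)=\prod_{\substack{p\le N\\ p\text{ prime}}}\left(1-\frac1{p^k}\right),\] where the limit is taken as $q$ tends to $1$ from within the unit disk.
   Context: For a partition $\lambda$, $|\lambda|$ is the sum of its parts and $\ell(\lambda)$ the number of parts. The partition M\"obius function is $\mu_{\mathcal P}(\emptyset)=1$, $\mu_{\mathcal P}(\lambda)=0$ if $\lambda$ has a repeated part, and $\mu_{\mathcal P}(\lambda)=(-1)^{\ell(\lambda)}$ otherwise; $\mu^*_{\mathcal P}:=-\mu_{\mathcal P}$.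
   Formalization: The limit is taken with q tending to 1 inside a region |q|<1, |1-q|<K(1-|q|), for some K>1 depending on k and N (this contains the radial limit), because the unrestricted limit from within the unit disk fails: for k=N=2, F is unbounded near exp(2πi/n) for every n divisible by 4. *)

theory Defs
  imports
    "HOL-Analysis.Analysis"
    "HOL-Library.Multiset"
    "HOL-Computational_Algebra.Primes"
begin

text \<open>
  An integer partition is the multiset of its parts: its size is \<open>sum_mset\<close>, its number
  of parts is the multiset \<open>size\<close>, its smallest part is \<open>Min_mset\<close>.
\<close>

definition partitions :: "nat multiset set" where
  "partitions = {\<nu>. 0 \<notin># \<nu>}"

definition partition_moebius :: "nat multiset \<Rightarrow> int" where
  "partition_moebius \<nu> =
     (if \<nu> = {#} then 1
      else if \<exists>i. count \<nu> i \<ge> 2 then 0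
      else (-1) ^ size \<nu>)"

definition partition_moebius_star :: "nat multiset \<Rightarrow> int" where
  "partition_moebius_star \<nu> = - partition_moebius \<nu>"

text \<open>
  For \<open>norm q < 1\<close> the family below is absolutely summable, being dominated by
  the generating function of partitions into distinct parts at \<open>norm q\<close>.
\<close>

definition F :: "nat set \<Rightarrow> complex \<Rightarrow> complex" where
  "F S q = (\<Sum>\<^sub>\<infinity>\<nu> \<in> {\<nu> \<in> partitions. \<nu> \<noteq> {#} \<and> Min_mset \<nu> \<in> S}.
     of_int (partition_moebius_star \<nu>) * q ^ sum_mset \<nu>)"

definition S_fr :: "nat \<Rightarrow> nat \<Rightarrow> nat set" where
  "S_fr k N = {n. n \<ge> 1 \<and> (\<forall>p. prime p \<and> p \<le> N \<longrightarrow> \<not> p ^ k dvd n)}"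

text \<open>
  The Stolz region of aperture \<open>K\<close> at the boundary point 1 of the unit disk. For \<open>K > 1\<close>
  it contains the radius \<open>[0, 1)\<close> and, near 1, a full sector about it.

  The limit \<open>q \<rightarrow> 1\<close> must be taken in such a region: without restriction on the
  approach it does not exist. Already for \<open>k = N = 2\<close>, \<open>F (S_fr k N)\<close> is unbounded near
  \<open>exp (2 * pi * \<i> / n)\<close> for every multiple \<open>n\<close> of 4, and these points accumulate at 1;
  and in that example the limit also fails in Stolz regions of large aperture.
\<close>

definition stolz_region :: "real \<Rightarrow> complex set" where
  "stolz_region K = {q. norm q < 1 \<and> norm (1 - q) < K * (1 - norm q)}"

end

theory Submission
  imports Defs
begin

text \<open>
  Only partitions into distinct parts contribute to \<open>F S q\<close>. Grouping them by their smallest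
  part \<open>n\<close> gives \<open>F S q = (q; q)\<^sub>\<infinity> * (\<Sum>n\<in>S. q ^ n / (q; q)\<^sub>n)\<close>. Inclusion and exclusion over
  the primes reduces the claim to sets of multiples of some \<open>D\<close>, for which the limit has to be
  \<open>1 / D\<close>; and the indicator of such a set is the average of \<open>z ^ n\<close> over the \<open>D\<close>-th roots
  of unity \<open>z\<close>. By Euler's product
  \<open>\<Sum>n. (z * q) ^ n / (q; q)\<^sub>n = 1 / (z * q; q)\<^sub>\<infinity>\<close>, the root \<open>z\<close> contributes
  \<open>(q; q)\<^sub>\<infinity> / (z * q; q)\<^sub>\<infinity>\<close>. This is 1 for \<open>z = 1\<close>, and for all other \<open>z\<close> it decays
  like \<open>exp (- c / (1 - norm q))\<close> in a sufficiently narrow Stolz region: replacing \<open>q\<close> by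
  \<open>norm q\<close> changes the logarithm by at most \<open>4 * norm (q - norm q) / (1 - norm q)\<^sup>2\<close>, and for
  real \<open>q\<close> every factor is explicitly bounded.
\<close>

section \<open>Euler's product for the series of reciprocal q-factorials\<close>

text \<open>The finite q-Pochhammer symbol (zq; q)_n. The product starts at exponent 1, so z = 1
  gives (q; q)_n and no factor vanishes for \<open>norm z\<close> at most 1.\<close>

definition qprod :: "complex \<Rightarrow> complex \<Rightarrow> nat \<Rightarrow> complex" where
  "qprod z q n = (\<Prod>m=1..n. 1 - z * q ^ m)"

text \<open>Keeping \<open>q ^ n\<close> in the coefficient makes the power series in z converge
  absolutely on the closed unit disk, where the roots of unity lie.\<close>

definition euler_coeff :: "complex \<Rightarrow> nat \<Rightarrow> complex" where
  "euler_coeff q n = q ^ n / qprod 1 q n"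

definition euler_series :: "complex \<Rightarrow> complex \<Rightarrow> complex" where
  "euler_series q z = (\<Sum>n. euler_coeff q n * z ^ n)"

lemma norm_mult_power_less_1:
  fixes z q :: complex
  assumes "norm q < 1" "norm z \<le> 1" "n \<ge> 1"
  shows "norm (z * q ^ n) < 1"
proof -
  have "norm (z * q ^ n) \<le> 1 * norm q ^ n"
    unfolding norm_mult norm_power using assms by (intro mult_right_mono) auto
  also have "norm q ^ n < 1"
    using assms by (intro power_less_one_iff[THEN iffD2]) auto
  finally show ?thesis by simp
qed

lemma one_minus_mult_power_nonzero:
  fixes z q :: complex
  assumes "norm q < 1" "norm z \<le> 1" "n \<ge> 1"
  shows "1 - z * q ^ n \<noteq> 0"
  using norm_mult_power_less_1[OF assms] by (metis norm_one order_less_irrefl right_minus_eq)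

lemma qprod_nonzero:
  assumes "norm q < 1" "norm z \<le> 1"
  shows "qprod z q n \<noteq> 0"
  unfolding qprod_def using one_minus_mult_power_nonzero[OF assms] by auto

lemma qprod_Suc: "qprod z q (Suc n) = qprod z q n * (1 - z * q ^ Suc n)"
  by (simp add: qprod_def)

lemma euler_coeff_0 [simp]: "euler_coeff q 0 = 1"
  by (simp add: euler_coeff_def qprod_def)

lemma euler_coeff_Suc:
  assumes "norm q < 1"
  shows "euler_coeff q (Suc n) * (1 - q ^ Suc n) = q * euler_coeff q n"
  using one_minus_mult_power_nonzero[OF assms, of 1 "Suc n"]
  by (simp add: euler_coeff_def qprod_Suc)

lemma summable_norm_euler_coeff:
  assumes q: "norm q < 1"
  shows "summable (\<lambda>n. norm (euler_coeff q n))"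
proof -
  \<comment> \<open>The coefficient ratio q / (1 - q^(n+1)) tends to q, so any c strictly between
    \<open>norm q\<close> and 1 serves in the ratio test; this is the midpoint.\<close>
  define c where "c = (1 + norm q) / 2"
  have c: "c < 1" "c > 0" "norm q < c"
    using q by (auto simp: c_def add_pos_nonneg)
  have "(\<lambda>n. c * (1 - norm q ^ Suc n)) \<longlonglongrightarrow> c * (1 - 0)"
    by (intro tendsto_intros LIMSEQ_Suc LIMSEQ_power_zero) (use q in auto)
  hence "eventually (\<lambda>n. norm q < c * (1 - norm q ^ Suc n)) sequentially"
    using c by (intro order_tendstoD) auto
  then obtain M where M: "norm q < c * (1 - norm q ^ Suc n)" if "n \<ge> M" for n
    unfolding eventually_sequentially by blast
  show ?thesis
  proof (rule summable_ratio_test[OF \<open>c < 1\<close>, of M])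
    fix n assume n: "n \<ge> M"
    define d where "d = norm (1 - q ^ Suc n)"
    have nz: "d > 0"
      using one_minus_mult_power_nonzero[OF q, of 1 "Suc n"] by (simp add: d_def)
    have "1 - norm q ^ Suc n \<le> d"
      unfolding d_def using norm_triangle_ineq2[of 1 "q ^ Suc n"] by (simp add: norm_power norm_mult)
    hence "norm q \<le> c * d"
      using M[OF n] c mult_left_mono[of "1 - norm q ^ Suc n" d c] by linarith
    hence "norm q * norm (euler_coeff q n) \<le> c * d * norm (euler_coeff q n)"
      by (rule mult_right_mono) auto
    moreover have "norm (euler_coeff q (Suc n)) * d = norm q * norm (euler_coeff q n)"
      unfolding d_def by (metis euler_coeff_Suc[OF q] norm_mult)
    ultimately have "norm (euler_coeff q (Suc n)) * d \<le> (c * norm (euler_coeff q n)) * d"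
      by (simp add: mult_ac)
    thus "norm (norm (euler_coeff q (Suc n))) \<le> c * norm (norm (euler_coeff q n))"
      using nz by simp
  qed
qed

lemma summable_euler_series:
  assumes q: "norm q < 1" and z: "norm z \<le> 1"
  shows "summable (\<lambda>n. euler_coeff q n * z ^ n)"
proof (rule summable_comparison_test[OF _ summable_norm_euler_coeff[OF q]], intro exI allI impI)
  fix n
  show "norm (euler_coeff q n * z ^ n) \<le> norm (euler_coeff q n)"
    unfolding norm_mult norm_power using z by (intro mult_right_le_one_le) (auto intro: power_le_one)
qed

text \<open>Subtracting the series at z and at zq multiplies the n-th term by 1 - q^n, which cancels
  the last factor of the denominator and leaves zq times the original series.\<close>

lemma euler_series_step:
  assumes q: "norm q < 1" and z: "norm z \<le> 1"
  shows "euler_series q z * (1 - z * q) = euler_series q (z * q)"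
proof -
  have zq: "norm (z * q) \<le> 1"
    using norm_mult_power_less_1[OF q z, of 1] by simp
  note s = summable_euler_series[OF q z] summable_euler_series[OF q zq]
  have "euler_series q z - euler_series q (z * q)
      = (\<Sum>n. euler_coeff q n * z ^ n - euler_coeff q n * (z * q) ^ n)"
    unfolding euler_series_def by (rule suminf_diff[OF s])
  \<comment> \<open>The constant terms cancel, so the sum can start at index 1.\<close>
  also have "\<dots> = (\<Sum>n. euler_coeff q (Suc n) * z ^ Suc n - euler_coeff q (Suc n) * (z * q) ^ Suc n)"
    using suminf_split_head[OF summable_diff[OF s]] by simp
  also have "\<dots> = (\<Sum>n. (z * q) * (euler_coeff q n * z ^ n))"
  proof (rule suminf_cong)
    fix n
    have "euler_coeff q (Suc n) * z ^ Suc n - euler_coeff q (Suc n) * (z * q) ^ Suc n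
        = (euler_coeff q (Suc n) * (1 - q ^ Suc n)) * z ^ Suc n"
      by (simp add: algebra_simps power_mult_distrib)
    also have "\<dots> = (z * q) * (euler_coeff q n * z ^ n)"
      unfolding euler_coeff_Suc[OF q] by (simp add: mult_ac)
    finally show "euler_coeff q (Suc n) * z ^ Suc n - euler_coeff q (Suc n) * (z * q) ^ Suc n
        = (z * q) * (euler_coeff q n * z ^ n)" .
  qed
  also have "\<dots> = (z * q) * euler_series q z"
    unfolding euler_series_def by (rule suminf_mult[OF s(1)])
  finally show ?thesis by (simp add: algebra_simps)
qed

lemma euler_series_mult_qprod:
  assumes q: "norm q < 1" and z: "norm z \<le> 1"
  shows "euler_series q z * qprod z q n = euler_series q (z * q ^ n)"
proof (induction n)
  case 0
  show ?case by (simp add: qprod_def)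
next
  case (Suc n)
  have "norm (z * q ^ n) \<le> 1"
    using z norm_mult_power_less_1[OF q z, of n] by (cases "n = 0") auto
  from euler_series_step[OF q this] show ?case
    unfolding qprod_Suc power_Suc2 mult.assoc[symmetric] Suc.IH .
qed

text \<open>Iterating the functional equation moves the argument to z q^n, which tends to 0, where
  the series is continuous with value 1.\<close>

lemma euler_product:
  assumes q: "norm q < 1" and z: "norm z \<le> 1"
  shows "(\<lambda>n. euler_series q z * qprod z q n) \<longlonglongrightarrow> 1"
proof -
  have "isCont (euler_series q) 0"
    unfolding euler_series_def[abs_def]
    by (rule isCont_powser[where K = 1]) (use summable_euler_series[OF q, of 1] in auto)
  moreover have "(\<lambda>n. z * q ^ n) \<longlonglongrightarrow> 0"
    by (intro tendsto_mult_right_zero LIMSEQ_power_zero q)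
  ultimately have "(\<lambda>n. euler_series q (z * q ^ n)) \<longlonglongrightarrow> euler_series q 0"
    by (rule isCont_tendsto_compose)
  thus ?thesis
    unfolding euler_series_mult_qprod[OF q z] by (simp add: euler_series_def)
qed

lemma euler_series_nonzero:
  assumes "norm q < 1" "norm z \<le> 1"
  shows "euler_series q z \<noteq> 0"
  using euler_product[OF assms] by (auto simp: LIMSEQ_const_iff)

lemma qprod_tendsto:
  assumes q: "norm q < 1" and z: "norm z \<le> 1"
  shows "qprod z q \<longlonglongrightarrow> 1 / euler_series q z"
proof -
  have "(\<lambda>n. euler_series q z * qprod z q n / euler_series q z) \<longlonglongrightarrow> 1 / euler_series q z"
    by (intro tendsto_intros euler_product assms euler_series_nonzero)
  thus ?thesis
    using euler_series_nonzero[OF assms] by simp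
qed

section \<open>Reduction of the partition sum to a series over the smallest part\<close>

text \<open>Enlarging the family to all subsets of its union turns the sum into a product of factors
  1 + r^m, each at most exp(r^m). The bound is independent of the family, so it yields absolute
  summability of the partition sum.\<close>

lemma sum_subsets_bound:
  fixes r :: real
  assumes r: "0 \<le> r" "r < 1" and "finite \<F>" "\<And>A. A \<in> \<F> \<Longrightarrow> finite A \<and> 0 \<notin> A"
  shows "(\<Sum>A\<in>\<F>. r ^ \<Sum>A) \<le> exp (1 / (1 - r))"
proof -
  have fin: "finite (\<Union>\<F>)" using assms by auto
  have "(\<Sum>A\<in>\<F>. r ^ \<Sum>A) \<le> (\<Sum>A\<in>Pow (\<Union>\<F>). r ^ \<Sum>A)"
    using fin r by (intro sum_mono2) auto
  also have "\<dots> = (\<Prod>m\<in>\<Union>\<F>. r ^ m + 1)"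
    using prod_add[OF fin, of "\<lambda>m. r ^ m" "\<lambda>_. 1"] by (simp add: power_sum)
  also have "\<dots> \<le> (\<Prod>m\<in>\<Union>\<F>. exp (r ^ m))"
    using r by (intro prod_mono) (auto intro: add_nonneg_nonneg simp: add.commute)
  also have "\<dots> = exp (\<Sum>m\<in>\<Union>\<F>. r ^ m)"
    by (simp add: exp_sum fin)
  also have "(\<Sum>m\<in>\<Union>\<F>. r ^ m) \<le> (\<Sum>m. r ^ m)"
    using r fin by (intro sum_le_suminf summable_geometric) auto
  also have "\<dots> = 1 / (1 - r)"
    using r by (intro suminf_geometric) auto
  finally show ?thesis by simp
qed

text \<open>Partitions with a repeated part have weight 0; the others are the images of finite sets
  under the injection \<open>mset_set\<close>.\<close>

lemma F_eq_infsum_finite_sets: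
  "F S q = (\<Sum>\<^sub>\<infinity>A | finite A \<and> 0 \<notin> A \<and> A \<noteq> {} \<and> Min A \<in> S. - ((-1) ^ card A) * q ^ \<Sum>A)"
proof -
  define X where "X = {A. finite A \<and> 0 \<notin> A \<and> A \<noteq> {} \<and> Min A \<in> S}"
  have inj: "inj_on mset_set X"
    by (rule inj_onI) (metis (no_types, lifting) X_def finite_set_mset_mset_set mem_Collect_eq)
  have "F S q = infsum (\<lambda>\<nu>. of_int (partition_moebius_star \<nu>) * q ^ sum_mset \<nu>) (mset_set ` X)"
    unfolding F_def
  proof (rule infsum_cong_neutral)
    fix \<nu> assume *: "\<nu> \<in> {\<nu> \<in> partitions. \<nu> \<noteq> {#} \<and> Min_mset \<nu> \<in> S} - mset_set ` X"
    have "\<exists>i. count \<nu> i \<ge> 2"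
    proof (rule ccontr)
      assume "\<not> (\<exists>i. count \<nu> i \<ge> 2)"
      hence "count \<nu> i = (if i \<in># \<nu> then 1 else 0)" for i
        using count_greater_zero_iff[of \<nu> i] by (metis One_nat_def Suc_1 leI less_Suc_eq less_one not_in_iff)
      hence "\<nu> = mset_set (set_mset \<nu>)"
        by (intro multiset_eqI) (simp add: count_mset_set')
      moreover have "set_mset \<nu> \<in> X"
        using * by (auto simp: X_def partitions_def)
      ultimately show False using * by blast
    qed
    thus "of_int (partition_moebius_star \<nu>) * q ^ sum_mset \<nu> = 0"
      using * by (auto simp: partition_moebius_star_def partition_moebius_def)
  qed (auto simp: X_def partitions_def mset_set_empty_iff)
  also have "\<dots> = infsum ((\<lambda>\<nu>. of_int (partition_moebius_star \<nu>) * q ^ sum_mset \<nu>) \<circ> mset_set) X"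
    by (rule infsum_reindex[OF inj])
  also have "\<dots> = (\<Sum>\<^sub>\<infinity>A\<in>X. - ((-1) ^ card A) * q ^ \<Sum>A)"
  proof (rule infsum_cong)
    fix A assume A: "A \<in> X"
    have "\<not> (\<exists>i. count (mset_set A) i \<ge> 2)"
      by (simp add: count_mset_set')
    moreover have "sum_mset (mset_set A) = \<Sum>A"
      by (simp add: sum_unfold_sum_mset)
    ultimately show "((\<lambda>\<nu>. of_int (partition_moebius_star \<nu>) * q ^ sum_mset \<nu>) \<circ> mset_set) A
        = - ((-1) ^ card A) * q ^ \<Sum>A"
      using A by (auto simp: X_def partition_moebius_star_def partition_moebius_def mset_set_empty_iff)
  qed
  finally show ?thesis by (simp add: X_def)
qed

text \<open>Removing the minimum n leaves an arbitrary subset of the larger numbers up to M. The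
  sign of the removed element absorbs the minus sign of the weight, and the subsets assemble into a
  product.\<close>

lemma sum_sets_with_Min:
  fixes q :: complex
  assumes "n \<in> {1..M}"
  shows "(\<Sum>A | A \<subseteq> {1..M} \<and> A \<noteq> {} \<and> Min A = n. - ((-1) ^ card A) * q ^ \<Sum>A)
       = q ^ n * (\<Prod>m\<in>{n<..M}. 1 - q ^ m)"
proof -
  have "(\<Sum>A | A \<subseteq> {1..M} \<and> A \<noteq> {} \<and> Min A = n. - ((-1) ^ card A) * q ^ \<Sum>A)
      = (\<Sum>B\<in>Pow {n<..M}. q ^ n * ((-1) ^ card B * q ^ \<Sum>B))"
  proof (rule sum.reindex_bij_witness[of _ "insert n" "\<lambda>A. A - {n}"])
    fix A assume A: "A \<in> {A. A \<subseteq> {1..M} \<and> A \<noteq> {} \<and> Min A = n}"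
    hence fin: "finite A" using finite_subset by blast
    hence n: "n \<in> A" using A Min_in by blast
    thus "insert n (A - {n}) = A" by blast
    show "A - {n} \<in> Pow {n<..M}"
      using A fin Min_le[of A] by (fastforce simp: order.strict_iff_order)
    have "card A = Suc (card (A - {n}))" "\<Sum>A = n + \<Sum>(A - {n})"
      by (rule card.remove[OF fin n], rule sum.remove[OF fin n])
    thus "q ^ n * ((-1) ^ card (A - {n}) * q ^ \<Sum>(A - {n})) = - ((-1) ^ card A) * q ^ \<Sum>A"
      by (simp add: power_add)
  next
    fix B assume B: "B \<in> Pow {n<..M}"
    thus "insert n B - {n} = B" by auto
    have "finite B" using B finite_subset by blast
    hence "Min (insert n B) = n"
      using B by (intro Min_eqI) auto
    thus "insert n B \<in> {A. A \<subseteq> {1..M} \<and> A \<noteq> {} \<and> Min A = n}"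
      using B assms by auto
  qed
  also have "\<dots> = q ^ n * (\<Prod>m\<in>{n<..M}. 1 - q ^ m)"
    by (subst prod_diff_conv_sum) (auto simp: sum_distrib_left power_sum)
  finally show ?thesis .
qed

lemma qprod_split:
  assumes "norm q < 1" "n \<le> M"
  shows "(\<Prod>m\<in>{n<..M}. 1 - q ^ m) = qprod 1 q M / qprod 1 q n"
proof -
  have "{1..M} = {1..n} \<union> {n<..M}" using assms by auto
  hence "qprod 1 q M = qprod 1 q n * (\<Prod>m\<in>{n<..M}. 1 - q ^ m)"
    unfolding qprod_def by (simp add: prod.union_disjoint ivl_disj_int)
  thus ?thesis using qprod_nonzero[OF assms(1), of 1 n] by simp
qed

text \<open>Summing over subsets of {1..M}, grouped by minimum, gives \<open>qprod 1 q M\<close>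
  times a partial sum of the series; as M grows, the first factor tends to (q; q)_\<infinity>, that
  is, \<open>1 / euler_series q 1\<close>.\<close>

lemma F_eq_euler_sum:
  assumes q: "norm q < 1"
  shows "F S q = (\<Sum>n. if n \<in> S \<and> n \<ge> 1 then euler_coeff q n else 0) / euler_series q 1"
proof -
  define X where "X = {A. finite A \<and> 0 \<notin> A \<and> A \<noteq> {} \<and> Min A \<in> S}"
  define Y where "Y M = {A. A \<subseteq> {1..M} \<and> A \<noteq> {} \<and> Min A \<in> S}" for M :: nat
  define t where "t A = - ((-1) ^ card A) * q ^ \<Sum>A" for A
  define e where "e n = (if n \<in> S \<and> n \<ge> 1 then euler_coeff q n else 0)" for n
  have "bdd_above (sum (\<lambda>A. norm (t A)) ` {\<F>. \<F> \<subseteq> X \<and> finite \<F>})"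
  proof (rule bdd_aboveI2)
    fix \<F> assume "\<F> \<in> {\<F>. \<F> \<subseteq> X \<and> finite \<F>}"
    thus "(\<Sum>A\<in>\<F>. norm (t A)) \<le> exp (1 / (1 - norm q))"
      using sum_subsets_bound[of "norm q" \<F>] q
      by (auto simp: t_def norm_mult norm_power X_def subset_iff)
  qed
  hence "(\<lambda>A. norm (t A)) summable_on X"
    by (rule nonneg_bdd_above_summable_on[OF norm_ge_zero])
  hence "t summable_on X" by (rule abs_summable_summable)
  hence "(sum t \<longlongrightarrow> F S q) (finite_subsets_at_top X)"
    unfolding F_eq_infsum_finite_sets X_def t_def[abs_def]
    by (simp add: infsum_tendsto)
  \<comment> \<open>The families \<open>Y M\<close> exhaust X, so the unordered sum may be computed
    along them.\<close>
  moreover have "filterlim Y (finite_subsets_at_top X) sequentially"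
    unfolding filterlim_finite_subsets_at_top
  proof (intro allI impI)
    fix \<F> assume \<F>: "finite \<F> \<and> \<F> \<subseteq> X"
    hence fin: "finite (\<Union>\<F>)" by (auto simp: X_def)
    show "\<forall>\<^sub>F M in sequentially. finite (Y M) \<and> \<F> \<subseteq> Y M \<and> Y M \<subseteq> X"
      unfolding eventually_sequentially
    proof (intro exI allI impI conjI)
      \<comment> \<open>Inserting 0 keeps \<open>Max\<close> meaningful when the union is
        empty.\<close>
      fix M assume M: "Max (insert 0 (\<Union>\<F>)) \<le> M"
      show "finite (Y M)" by (simp add: Y_def)
      show "Y M \<subseteq> X" by (auto simp: X_def Y_def intro: finite_subset)
      show "\<F> \<subseteq> Y M"
      proof
        fix A assume A: "A \<in> \<F>"
        have "a \<in> {1..M}" if "a \<in> A" for a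
        proof -
          have "a \<le> M" using M fin that A by auto
          moreover have "a \<noteq> 0" using that A \<F> by (auto simp: X_def)
          ultimately show ?thesis by simp
        qed
        thus "A \<in> Y M" using A \<F> by (auto simp: X_def Y_def)
      qed
    qed
  qed
  ultimately have lim: "(\<lambda>M. sum t (Y M)) \<longlonglongrightarrow> F S q"
    by (rule filterlim_compose)
  have "sum t (Y M) = qprod 1 q M * (\<Sum>n<Suc M. e n)" for M
  proof -
    have "sum t (Y M) = (\<Sum>n\<in>S \<inter> {1..M}. sum t {A \<in> Y M. Min A = n})"
    proof (rule sum.group[symmetric])
      show "Min ` Y M \<subseteq> S \<inter> {1..M}"
      proof safe
        fix A assume A: "A \<in> Y M"
        hence "finite A" "A \<noteq> {}" by (auto simp: Y_def intro: finite_subset)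
        hence "Min A \<in> A" by (rule Min_in)
        thus "Min A \<in> S" "Min A \<in> {1..M}" using A by (auto simp: Y_def)
      qed
    qed (auto simp: Y_def)
    also have "\<dots> = (\<Sum>n\<in>S \<inter> {1..M}. qprod 1 q M * e n)"
    proof (rule sum.cong[OF refl])
      fix n assume n: "n \<in> S \<inter> {1..M}"
      hence "{A \<in> Y M. Min A = n} = {A. A \<subseteq> {1..M} \<and> A \<noteq> {} \<and> Min A = n}"
        by (auto simp: Y_def)
      hence "sum t {A \<in> Y M. Min A = n} = q ^ n * (\<Prod>m\<in>{n<..M}. 1 - q ^ m)"
        using sum_sets_with_Min[of n M q] n by (simp add: t_def[abs_def])
      also have "\<dots> = qprod 1 q M * e n"
        using n qprod_split[OF q, of n M] by (simp add: e_def euler_coeff_def)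
      finally show "sum t {A \<in> Y M. Min A = n} = qprod 1 q M * e n" .
    qed
    also have "\<dots> = (\<Sum>n<Suc M. qprod 1 q M * e n)"
      by (rule sum.mono_neutral_left) (auto simp: e_def)
    finally show ?thesis by (simp only: sum_distrib_left)
  qed
  with lim have lim: "(\<lambda>M. qprod 1 q M * (\<Sum>n<Suc M. e n)) \<longlonglongrightarrow> F S q"
    by simp
  have "summable e"
    by (rule summable_comparison_test[OF _ summable_norm_euler_coeff[OF q]]) (auto simp: e_def)
  hence "(\<lambda>M. \<Sum>n<Suc M. e n) \<longlonglongrightarrow> suminf e"
    using LIMSEQ_Suc[OF summable_LIMSEQ] by blast
  hence "(\<lambda>M. qprod 1 q M * (\<Sum>n<Suc M. e n)) \<longlonglongrightarrow> 1 / euler_series q 1 * suminf e"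
    by (intro tendsto_mult qprod_tendsto q) auto
  from LIMSEQ_unique[OF lim this] show ?thesis by (simp add: e_def[abs_def])
qed

section \<open>Decay of the Euler series off the point 1\<close>

text \<open>For s < 1, dividing by 1 - s^2 compares (n+1) s^n with 1 + s^2 + ... + s^(2n), an
  instance of the arithmetic-geometric mean inequality.\<close>

lemma Suc_mult_power_le:
  fixes s :: real
  assumes "0 \<le> s" "s \<le> 1"
  shows "real (Suc n) * s ^ n * (1 - s\<^sup>2) \<le> 1 - s ^ (2 * Suc n)"
proof (induction n)
  case (Suc n)
  \<comment> \<open>This product is exactly the slack left in the induction step.\<close>
  have "0 \<le> (1 - s) * (1 - s ^ Suc n) * (1 - s ^ Suc (Suc n))"
    using assms by (intro mult_nonneg_nonneg) (auto simp del: power_Suc intro: power_le_one)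
  also have "\<dots> = 1 - s ^ (2 * Suc (Suc n)) - s * (1 - s ^ (2 * Suc n)) - s ^ Suc n * (1 - s\<^sup>2)"
    by (simp add: algebra_simps power2_eq_square mult_2 mult_2_right power_add)
  also have "\<dots> \<le> 1 - s ^ (2 * Suc (Suc n)) - s * (real (Suc n) * s ^ n * (1 - s\<^sup>2))
                  - s ^ Suc n * (1 - s\<^sup>2)"
    using mult_left_mono[OF Suc.IH assms(1)] by simp
  also have "\<dots> = 1 - s ^ (2 * Suc (Suc n)) - real (Suc (Suc n)) * s ^ Suc n * (1 - s\<^sup>2)"
    by (simp add: algebra_simps)
  finally show ?case by simp
qed simp

text \<open>The left side will bound the relative change of one factor of \<open>qprod\<close> per
  unit change of q; passing to \<open>sqrt r\<close> provides a summable geometric majorant.\<close>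

lemma Suc_mult_power_div_le:
  fixes r :: real
  assumes "0 \<le> r" "r < 1"
  shows "real (Suc n) * r ^ n / (1 - r ^ Suc n) \<le> sqrt r ^ n / (1 - r)"
proof -
  define s where "s = sqrt r"
  have s: "0 \<le> s" "s \<le> 1" "r = s\<^sup>2" using assms by (auto simp: s_def)
  have "r ^ Suc n < 1" using assms by (intro power_less_one_iff[THEN iffD2]) auto
  moreover have "real (Suc n) * r ^ n * (1 - r) \<le> s ^ n * (1 - r ^ Suc n)"
  proof -
    have "real (Suc n) * r ^ n * (1 - r) = s ^ n * (real (Suc n) * s ^ n * (1 - s\<^sup>2))"
      by (simp add: s(3) power2_eq_square power_mult_distrib)
    also have "\<dots> \<le> s ^ n * (1 - s ^ (2 * Suc n))"
      using s by (intro mult_left_mono Suc_mult_power_le) auto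
    also have "s ^ (2 * Suc n) = r ^ Suc n"
      unfolding s(3) power_mult ..
    finally show ?thesis .
  qed
  ultimately show ?thesis
    using assms unfolding s_def[symmetric] by (simp add: divide_simps mult_ac)
qed

lemma norm_diff_power_Suc_le:
  fixes a b :: complex
  assumes "norm a \<le> r" "norm b \<le> r"
  shows "norm (a ^ Suc n - b ^ Suc n) \<le> norm (a - b) * (real (Suc n) * r ^ n)"
proof -
  have "norm (\<Sum>p<Suc n. a ^ p * b ^ (n - p)) \<le> (\<Sum>p<Suc n. r ^ n)"
  proof (rule sum_norm_le)
    fix p assume p: "p \<in> {..<Suc n}"
    have "norm (a ^ p * b ^ (n - p)) \<le> r ^ p * r ^ (n - p)"
      unfolding norm_mult norm_power using assms order.trans[OF norm_ge_zero assms(1)]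
      by (intro mult_mono power_mono) auto
    also have "\<dots> = r ^ n" using p by (simp flip: power_add)
    finally show "norm (a ^ p * b ^ (n - p)) \<le> r ^ n" .
  qed
  thus ?thesis
    unfolding diff_power_eq_sum norm_mult by (intro mult_left_mono) auto
qed

text \<open>The factor with exponent m has norm at least 1 - r^m and changes by at most m r^(m-1)
  \<open>norm (a - b)\<close>. The relative changes sum to order 1/(1-r)^2. The roles of a and b can
  be exchanged.\<close>

lemma norm_qprod_le_rotate:
  fixes a b z :: complex
  assumes a: "norm a = r" and b: "norm b = r" and r: "r < 1" and z: "norm z \<le> 1"
  shows "norm (qprod z a n) \<le> norm (qprod z b n) * exp (2 * norm (a - b) / (1 - r)\<^sup>2)"
proof -
  have r0: "r \<ge> 0" using a by auto
  define s where "s = sqrt r"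
  have s: "0 \<le> s" "s < 1" "r = s\<^sup>2" using r r0 by (auto simp: s_def)
  define d where "d m = norm (a - b) * (s ^ m / (1 - r))" for m
  have factor: "norm (1 - z * a ^ Suc m) \<le> norm (1 - z * b ^ Suc m) * exp (d m)" for m
  proof -
    define u where "u = norm (1 - z * b ^ Suc m)"
    have rm: "1 - r ^ Suc m > 0"
      using r r0 power_less_one_iff[of r "Suc m"] by simp
    have "norm (z * b ^ Suc m) \<le> 1 * r ^ Suc m"
      unfolding norm_mult norm_power b using z r0 by (intro mult_right_mono) auto
    hence u: "1 - r ^ Suc m \<le> u"
      unfolding u_def using norm_triangle_ineq2[of 1 "z * b ^ Suc m"] by simp
    have "norm (z * (b ^ Suc m - a ^ Suc m)) \<le> 1 * (norm (a - b) * (real (Suc m) * r ^ m))"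
      unfolding norm_mult using z norm_diff_power_Suc_le[of b r a m] a b
      by (intro mult_mono) (auto simp: norm_minus_commute)
    moreover have "norm (1 - z * a ^ Suc m) \<le> u + norm (z * (b ^ Suc m - a ^ Suc m))"
      unfolding u_def using norm_triangle_ineq[of "1 - z * b ^ Suc m" "z * (b ^ Suc m - a ^ Suc m)"]
      by (simp add: algebra_simps)
    ultimately have "norm (1 - z * a ^ Suc m) \<le> u + norm (a - b) * (real (Suc m) * r ^ m)"
      by linarith
    also have "real (Suc m) * r ^ m \<le> (1 - r ^ Suc m) * (s ^ m / (1 - r))"
      using Suc_mult_power_div_le[OF r0 r, of m] rm
      by (simp add: s_def pos_divide_le_eq mult.commute)
    also have "(1 - r ^ Suc m) * (s ^ m / (1 - r)) \<le> u * (s ^ m / (1 - r))"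
      using u s r by (intro mult_right_mono) auto
    also have "u + norm (a - b) * (u * (s ^ m / (1 - r))) = u * (1 + d m)"
      by (simp add: d_def algebra_simps)
    also have "\<dots> \<le> u * exp (d m)"
      by (intro mult_left_mono exp_ge_add_one_self) (auto simp: u_def)
    finally show ?thesis
      by (simp add: u_def mult_left_mono)
  qed
  have "norm (qprod z a n) = (\<Prod>m<n. norm (1 - z * a ^ Suc m))"
    unfolding qprod_def prod_norm[symmetric] by (simp add: prod.atLeast1_atMost_eq)
  also have "\<dots> \<le> (\<Prod>m<n. norm (1 - z * b ^ Suc m) * exp (d m))"
    by (intro prod_mono conjI factor) auto
  also have "\<dots> = norm (qprod z b n) * exp (\<Sum>m<n. d m)"
    unfolding qprod_def prod_norm[symmetric] prod.distrib exp_sum[OF finite_lessThan]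
    using prod.atLeast1_atMost_eq[of "\<lambda>m. norm (1 - z * b ^ m)" n] by simp
  also have "\<dots> \<le> norm (qprod z b n) * exp (2 * norm (a - b) / (1 - r)\<^sup>2)"
  proof -
    have "(\<Sum>m<n. s ^ m) \<le> (\<Sum>m. s ^ m)"
      using s by (intro sum_le_suminf summable_geometric) auto
    also have "\<dots> = 1 / (1 - s)" using s by (intro suminf_geometric) auto
    \<comment> \<open>Since r = s^2, the constant 2 comes from 1 + s being at most 2.\<close>
    also have "\<dots> = (1 + s) / (1 - r)"
      using s r by (simp add: divide_simps) (simp add: power2_eq_square algebra_simps)
    also have "\<dots> \<le> 2 / (1 - r)" using s r by (intro divide_right_mono) auto
    finally have "norm (a - b) / (1 - r) * (\<Sum>m<n. s ^ m) \<le> norm (a - b) / (1 - r) * (2 / (1 - r))"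
      using r by (intro mult_left_mono) auto
    hence "(\<Sum>m<n. d m) \<le> 2 * norm (a - b) / (1 - r)\<^sup>2"
      unfolding d_def sum_distrib_left by (simp add: power2_eq_square mult.commute)
    thus ?thesis by (intro mult_left_mono) auto
  qed
  finally show ?thesis .
qed

text \<open>The squared norm of 1 - zx exceeds (1-x)^2 by at least x(1 - Re z) and is at most 4, a
  relative gain of x(1 - Re z)/4; the square root halves it to the exponent with 8. The value z = 0
  is included because it later removes the constant term of the series.\<close>

lemma one_minus_le_norm_one_minus_mult:
  fixes z :: complex and x :: real
  assumes x: "0 \<le> x" "x \<le> 1" and z: "norm z = 1 \<or> z = 0"
  shows "norm (1 - complex_of_real x) \<le> norm (1 - z * of_real x) * exp (- (x * (1 - Re z) / 8))"
proof (cases "z * of_real x = 1")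
  case True
  hence "norm z * x = 1" using x by (metis abs_of_nonneg norm_mult norm_of_real norm_one)
  with z have "x = 1" "norm z = 1" by auto
  thus ?thesis by simp
next
  case False
  define u where "u = (norm (1 - z * of_real x))\<^sup>2"
  have u0: "u > 0" using False by (auto simp: u_def)
  have Re: "Re z \<le> 1" using z complex_Re_le_cmod[of z] by auto
  have "norm (1 - z * of_real x) \<le> 1 + norm (z * complex_of_real x)"
    using norm_triangle_ineq4[of 1 "z * of_real x"] by simp
  also have "norm (z * complex_of_real x) \<le> 1 * 1"
    unfolding norm_mult using x z by (intro mult_mono) auto
  finally have "norm (1 - z * of_real x) \<le> 2" by simp
  hence u4: "u \<le> 4" unfolding u_def using power_mono[of _ 2 2] by fastforce
  have u_eq: "u = 1 - 2 * x * Re z + (norm z)\<^sup>2 * x\<^sup>2"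
    by (simp add: u_def cmod_power2) (simp add: power2_eq_square algebra_simps)
  have "x * x \<le> x * 1" using x by (intro mult_left_mono) auto
  hence 1: "u - (1 - x)\<^sup>2 \<ge> x * (1 - Re z)"
    unfolding u_eq using z Re x mult_nonneg_nonneg[of x "1 - Re z"]
    by (auto simp: power2_eq_square algebra_simps)
  have 2: "u * (x * (1 - Re z) / 4) \<le> 4 * (x * (1 - Re z) / 4)"
    using u4 x Re by (intro mult_right_mono) auto
  have "u * (1 + - (x * (1 - Re z) / 4)) = u - u * (x * (1 - Re z) / 4)"
    by (simp only: distrib_left mult_1_right mult_minus_right diff_conv_add_uminus)
  with 1 2 have "(1 - x)\<^sup>2 \<le> u * (1 + - (x * (1 - Re z) / 4))"
    by linarith
  also have "\<dots> \<le> u * exp (- (x * (1 - Re z) / 4))"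
    using u0 by (intro mult_left_mono exp_ge_add_one_self) auto
  also have "\<dots> = (norm (1 - z * of_real x) * exp (- (x * (1 - Re z) / 8)))\<^sup>2"
    by (simp add: u_def power_mult_distrib flip: exp_double)
  finally have "1 - x \<le> norm (1 - z * of_real x) * exp (- (x * (1 - Re z) / 8))"
    by (rule power2_le_imp_le) auto
  moreover have "norm (1 - complex_of_real x) = 1 - x"
    using x by (metis abs_of_nonneg diff_ge_0_iff_ge norm_of_real of_real_1 of_real_diff)
  ultimately show ?thesis by simp
qed

lemma norm_qprod_real_le:
  fixes z :: complex and r :: real
  assumes r: "0 \<le> r" "r < 1" and z: "norm z = 1 \<or> z = 0"
  shows "norm (qprod 1 (of_real r) n)
           \<le> norm (qprod z (of_real r) n) * exp (- ((1 - Re z) / 8 * (\<Sum>m=1..n. r ^ m)))"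
proof -
  have "norm (qprod 1 (of_real r) n) = (\<Prod>m=1..n. norm (1 - complex_of_real (r ^ m)))"
    by (simp add: qprod_def prod_norm)
  also have "\<dots> \<le> (\<Prod>m=1..n. norm (1 - z * of_real (r ^ m)) * exp (- (r ^ m * (1 - Re z) / 8)))"
    using r by (intro prod_mono conjI one_minus_le_norm_one_minus_mult z power_le_one) auto
  also have "\<dots> = norm (qprod z (of_real r) n) * exp (\<Sum>m=1..n. - (r ^ m * (1 - Re z) / 8))"
    by (simp add: qprod_def prod.distrib exp_sum prod_norm)
  also have "(\<Sum>m=1..n. - (r ^ m * (1 - Re z) / 8)) = - ((1 - Re z) / 8 * (\<Sum>m=1..n. r ^ m))"
    unfolding sum_distrib_left sum_negf[symmetric] by (intro sum.cong) (auto simp: field_simps)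
  finally show ?thesis .
qed

text \<open>The ratio is (q; q)_\<infinity> / (zq; q)_\<infinity>. One rotation takes q to
  \<open>norm q\<close> in the first product and another returns to q in the second, each costing E
  in the exponent; the comparison at real argument in between supplies the gain.\<close>

lemma norm_euler_series_ratio_le:
  fixes z q :: complex
  assumes q: "norm q < 1" and z: "norm z = 1 \<or> z = 0"
  shows "norm (euler_series q z / euler_series q 1)
           \<le> exp (4 * norm (q - of_real (norm q)) / (1 - norm q)\<^sup>2
                 - (1 - Re z) / 8 * (norm q / (1 - norm q)))"
proof -
  define r where "r = norm q"
  have r: "0 \<le> r" "r < 1" using q by (auto simp: r_def)
  have z1: "norm z \<le> 1" using z by auto
  define E where "E = 2 * norm (q - of_real r) / (1 - r)\<^sup>2"
  define c where "c = (1 - Re z) / 8"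
  have le: "norm (qprod 1 q n) \<le> norm (qprod z q n) * exp (2 * E - c * (\<Sum>m=1..n. r ^ m))" for n
  proof -
    have "norm (qprod 1 q n) \<le> norm (qprod 1 (of_real r) n) * exp E"
      unfolding E_def using r by (intro norm_qprod_le_rotate) (auto simp: r_def)
    also have "\<dots> \<le> norm (qprod z (of_real r) n) * exp (- (c * (\<Sum>m=1..n. r ^ m))) * exp E"
      unfolding c_def by (intro mult_right_mono norm_qprod_real_le r z) auto
    also have "\<dots> \<le> norm (qprod z q n) * exp E * exp (- (c * (\<Sum>m=1..n. r ^ m))) * exp E"
    proof (intro mult_right_mono)
      show "norm (qprod z (of_real r) n) \<le> norm (qprod z q n) * exp E"
        unfolding E_def norm_minus_commute[of q]
        by (rule norm_qprod_le_rotate) (use r z1 in \<open>auto simp flip: r_def\<close>)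
    qed auto
    also have "\<dots> = norm (qprod z q n) * exp (2 * E - c * (\<Sum>m=1..n. r ^ m))"
      unfolding mult.assoc mult_exp_exp by simp
    finally show ?thesis .
  qed
  have "(\<lambda>m. r ^ Suc m) sums (r * (1 / (1 - r)))"
    using sums_mult[OF geometric_sums[of r], of r] r by simp
  hence geo: "(\<lambda>n. \<Sum>m=1..n. r ^ m) \<longlonglongrightarrow> r / (1 - r)"
    unfolding sums_def by (simp add: sum.atLeast1_atMost_eq)
  have "norm (1 / euler_series q 1)
      \<le> norm (1 / euler_series q z) * exp (2 * E - c * (r / (1 - r)))"
  proof (rule LIMSEQ_le)
    show "(\<lambda>n. norm (qprod 1 q n)) \<longlonglongrightarrow> norm (1 / euler_series q 1)"
      by (intro tendsto_norm qprod_tendsto q) auto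
    show "(\<lambda>n. norm (qprod z q n) * exp (2 * E - c * (\<Sum>m=1..n. r ^ m)))
        \<longlonglongrightarrow> norm (1 / euler_series q z) * exp (2 * E - c * (r / (1 - r)))"
      by (intro tendsto_intros qprod_tendsto geo q z1)
  qed (use le in auto)
  hence "norm (euler_series q z) * norm (1 / euler_series q 1)
      \<le> norm (euler_series q z) * (norm (1 / euler_series q z) * exp (2 * E - c * (r / (1 - r))))"
    by (rule mult_left_mono) auto
  thus ?thesis
    using euler_series_nonzero[OF q z1] by (simp add: norm_divide E_def c_def r_def)
qed

text \<open>With r = \<open>norm q\<close>, |1-q|^2 = (1-r)^2 + 2(r - Re q) and |q-r|^2 = 2r(r - Re
  q). The aperture is chosen so that (1-r)^2 cancels, leaving a bound on r - Re q.\<close>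

lemma stolz_region_norm_diff_le:
  assumes q: "q \<in> stolz_region (sqrt (1 + \<epsilon>\<^sup>2))" and \<epsilon>: "\<epsilon> \<ge> 0"
  shows "norm (q - of_real (norm q)) \<le> \<epsilon> * (1 - norm q)"
proof -
  define r where "r = norm q"
  have r: "0 \<le> r" "r < 1" and le: "norm (1 - q) < sqrt (1 + \<epsilon>\<^sup>2) * (1 - r)"
    using q by (auto simp: stolz_region_def r_def)
  have r2: "r\<^sup>2 = (Re q)\<^sup>2 + (Im q)\<^sup>2" by (simp add: r_def cmod_power2)
  have Re: "Re q \<le> r" unfolding r_def by (rule complex_Re_le_cmod)
  have "(norm (1 - q))\<^sup>2 \<le> (sqrt (1 + \<epsilon>\<^sup>2) * (1 - r))\<^sup>2"
    using le by (intro power_mono) auto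
  also have "\<dots> = (1 + \<epsilon>\<^sup>2) * (1 - r)\<^sup>2"
    by (simp add: power_mult_distrib)
  also have "(norm (1 - q))\<^sup>2 = (1 - r)\<^sup>2 + 2 * (r - Re q)"
    using r2 by (simp add: cmod_power2) (simp add: power2_eq_square algebra_simps)
  finally have "2 * (r - Re q) \<le> \<epsilon>\<^sup>2 * (1 - r)\<^sup>2"
    by (simp add: algebra_simps)
  moreover have "(norm (q - of_real r))\<^sup>2 = r * (2 * (r - Re q))"
    using r2 by (simp add: cmod_power2) (simp add: power2_eq_square algebra_simps)
  moreover have "r * (2 * (r - Re q)) \<le> 1 * (2 * (r - Re q))"
    using r Re by (intro mult_right_mono) auto
  ultimately have "(norm (q - of_real r))\<^sup>2 \<le> (\<epsilon> * (1 - r))\<^sup>2"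
    by (simp add: power_mult_distrib)
  thus ?thesis
    unfolding r_def by (rule power2_le_imp_le) (use q \<epsilon> in \<open>auto simp: stolz_region_def\<close>)
qed

text \<open>
  In the bound \<open>norm_euler_series_ratio_le\<close>, a Stolz region makes the phase error and the gain
  of the same order \<open>1 / (1 - norm q)\<close>, so the aperture has to be small compared to \<open>\<delta>\<close>.
\<close>

lemma euler_series_ratio_tendsto_0:
  fixes z :: complex
  assumes z: "norm z = 1 \<or> z = 0" and \<delta>: "\<delta> > 0" "\<delta> \<le> 1 - Re z"
  shows "((\<lambda>q. euler_series q z / euler_series q 1) \<longlongrightarrow> 0)
           (at 1 within stolz_region (sqrt (1 + (\<delta> / 128)\<^sup>2)))" (is "(_ \<longlongrightarrow> 0) ?flt")
proof (rule Lim_null_comparison)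
  have "((\<lambda>q. 32 / \<delta> * (1 - norm q)) \<longlongrightarrow> 32 / \<delta> * (1 - norm (1 :: complex))) ?flt"
    by (intro tendsto_intros)
  thus "((\<lambda>q. 32 / \<delta> * (1 - norm q)) \<longlongrightarrow> 0) ?flt" by simp
  show "\<forall>\<^sub>F q in ?flt. norm (euler_series q z / euler_series q 1) \<le> 32 / \<delta> * (1 - norm q)"
    unfolding eventually_at
  proof (intro exI[of _ "1/2"] conjI ballI impI)
    fix q :: complex
    assume q: "q \<in> stolz_region (sqrt (1 + (\<delta> / 128)\<^sup>2))" "q \<noteq> 1 \<and> dist q 1 < 1 / 2"
    define r where "r = norm q"
    have r1: "r < 1" using q by (auto simp: stolz_region_def r_def)
    have r2: "r \<ge> 1 / 2"
      using q norm_triangle_ineq2[of 1 q] by (simp add: r_def dist_norm norm_minus_commute)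
    \<comment> \<open>The constant 128 makes the phase error at most y, while r at least 1/2 makes
      the gain at least 2y; the net exponent is at most -y.\<close>
    define y where "y = \<delta> / 32 / (1 - r)"
    have y: "y > 0" using \<delta> r1 by (simp add: y_def)
    have "4 * norm (q - of_real r) / (1 - r)\<^sup>2 \<le> 4 * (\<delta> / 128 * (1 - r)) / (1 - r)\<^sup>2"
      unfolding r_def using stolz_region_norm_diff_le[OF q(1)] \<delta>
      by (intro divide_right_mono mult_left_mono) auto
    also have "\<dots> = y" using r1 by (simp add: y_def power2_eq_square)
    finally have 1: "4 * norm (q - of_real r) / (1 - r)\<^sup>2 \<le> y" .
    have "\<delta> / 8 * ((1 / 2) / (1 - r)) \<le> (1 - Re z) / 8 * (r / (1 - r))"
      using \<delta> r1 r2 by (intro mult_mono divide_right_mono) auto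
    moreover have "\<delta> / 8 * ((1 / 2) / (1 - r)) = 2 * y"
      using r1 by (simp add: y_def divide_simps)
    ultimately have 2: "2 * y \<le> (1 - Re z) / 8 * (r / (1 - r))" by simp
    have "norm (euler_series q z / euler_series q 1) \<le> exp (- y)"
      using norm_euler_series_ratio_le[of q z] r1 z 1 2 unfolding r_def
      by (smt (verit) exp_le_cancel_iff)
    also have "\<dots> = 1 / exp y" by (simp add: exp_minus divide_inverse)
    \<comment> \<open>Exponential decay is weakened to a bound linear in 1 - r, which visibly tends
      to 0.\<close>
    also have "\<dots> \<le> 1 / y"
      using y order.trans[OF _ exp_ge_add_one_self[of y], of y] by (intro divide_left_mono) auto
    also have "\<dots> = 32 / \<delta> * (1 - r)" by (simp add: y_def)
    finally show "norm (euler_series q z / euler_series q 1) \<le> 32 / \<delta> * (1 - norm q)"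
      by (simp add: r_def)
  qed auto
qed

section \<open>Multiples of a fixed modulus\<close>

lemma sum_roots_of_unity_power:
  assumes D: "D > 0"
  shows "(\<Sum>z | z ^ D = (1::complex). z ^ n) = (if D dvd n then of_nat D else 0)"
proof -
  define w where "w = cis (2 * pi * real n / real D)"
  have w1: "w = 1 \<longleftrightarrow> D dvd n"
    using complex_root_unity_eq_1[of D n] D by (simp add: w_def cis_conv_exp mult_ac)
  have wD: "w ^ D = 1"
    using D cis_multiple_2pi[of "real n"] by (simp add: w_def Complex.DeMoivre)
  have "(\<Sum>z | z ^ D = (1::complex). z ^ n) = (\<Sum>j<D. cis (2 * pi * real j / real D) ^ n)"
    using sum.reindex_bij_betw[OF Complex.bij_betw_roots_unity[OF D], of "\<lambda>z. z ^ n"] by simp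
  also have "\<dots> = (\<Sum>j<D. w ^ j)"
    by (simp add: w_def Complex.DeMoivre mult_ac)
  also have "\<dots> = (if D dvd n then of_nat D else 0)"
    using w1 wD by (auto simp: geometric_sum)
  finally show ?thesis .
qed

text \<open>Averaging over the D-th roots of unity selects the multiples of D, including n = 0,
  which is no smallest part. The subtracted \<open>euler_series q 0\<close> is that term, since
  \<open>0 ^ n\<close> is 1 only at n = 0; in this form it is the case z = 0 of the decay
  estimate.\<close>

lemma F_multiples_eq:
  assumes q: "norm q < 1" and D: "D > 0"
  shows "F {n. D dvd n} q = 1 / of_nat D * (\<Sum>z | z ^ D = 1. euler_series q z / euler_series q 1)
           - euler_series q 0 / euler_series q 1"
proof -
  let ?U = "{z::complex. z ^ D = 1}"
  have fin: "finite ?U" using D by (intro finite_roots_unity) auto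
  have U: "norm z \<le> 1" if "z \<in> ?U" for z
    using that D power_eq_1_iff[of z D] by auto
  note s = summable_euler_series[OF q]
  have sU: "summable (\<lambda>n. \<Sum>z\<in>?U. euler_coeff q n * z ^ n)"
    by (intro summable_sum s U)
  have s0: "summable (\<lambda>n. euler_coeff q n * 0 ^ n)" by (intro s) auto
  have "(\<Sum>n. if n \<in> {n. D dvd n} \<and> n \<ge> 1 then euler_coeff q n else 0)
      = (\<Sum>n. 1 / of_nat D * (\<Sum>z\<in>?U. euler_coeff q n * z ^ n) - euler_coeff q n * 0 ^ n)"
  proof (rule suminf_cong)
    fix n
    have "(\<Sum>z\<in>?U. euler_coeff q n * z ^ n) = euler_coeff q n * (if D dvd n then of_nat D else 0)"
      unfolding sum_distrib_left[symmetric] sum_roots_of_unity_power[OF D] ..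
    thus "(if n \<in> {n. D dvd n} \<and> n \<ge> 1 then euler_coeff q n else 0)
        = 1 / of_nat D * (\<Sum>z\<in>?U. euler_coeff q n * z ^ n) - euler_coeff q n * 0 ^ n"
      using D by (cases "n = 0") auto
  qed
  also have "\<dots> = (\<Sum>n. 1 / of_nat D * (\<Sum>z\<in>?U. euler_coeff q n * z ^ n)) - euler_series q 0"
    unfolding euler_series_def by (intro suminf_diff[symmetric] summable_mult sU s0)
  also have "(\<Sum>n. 1 / of_nat D * (\<Sum>z\<in>?U. euler_coeff q n * z ^ n))
      = 1 / of_nat D * (\<Sum>n. \<Sum>z\<in>?U. euler_coeff q n * z ^ n)"
    by (rule suminf_mult[OF sU])
  also have "(\<Sum>n. \<Sum>z\<in>?U. euler_coeff q n * z ^ n) = (\<Sum>z\<in>?U. euler_series q z)"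
    unfolding euler_series_def by (intro suminf_sum s U)
  finally show ?thesis
    unfolding F_eq_euler_sum[OF q] by (simp add: diff_divide_distrib sum_divide_distrib mult.commute)
qed

text \<open>Only the root z = 1 survives in the limit, contributing 1/D. The gap \<delta> is a
  parameter so that one Stolz region can serve several moduli; \<delta> \<le> 1 covers the term z =
  0.\<close>

lemma F_multiples_tendsto:
  fixes D :: nat
  assumes D: "D > 0" and \<delta>: "0 < \<delta>" "\<delta> \<le> 1"
    and roots: "\<And>z::complex. z ^ D = 1 \<Longrightarrow> z \<noteq> 1 \<Longrightarrow> \<delta> \<le> 1 - Re z"
  shows "(F {n. D dvd n} \<longlongrightarrow> 1 / of_nat D) (at 1 within stolz_region (sqrt (1 + (\<delta> / 128)\<^sup>2)))"
    (is "(_ \<longlongrightarrow> _) ?flt")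
proof -
  let ?U = "{z::complex. z ^ D = 1}"
  let ?G = "\<lambda>z q. euler_series q z / euler_series q 1"
  have fin: "finite ?U" using D by (intro finite_roots_unity) auto
  have ev: "\<forall>\<^sub>F q in ?flt. norm q < 1"
    unfolding eventually_at by (auto intro!: exI[of _ 1] simp: stolz_region_def)
  have "(?G z \<longlongrightarrow> (if z = 1 then 1 else 0)) ?flt" if "z \<in> ?U" for z
  proof (cases "z = 1")
    case True
    have "\<forall>\<^sub>F q in ?flt. ?G z q = 1"
      using ev by eventually_elim (use True euler_series_nonzero[of _ 1] in auto)
    thus ?thesis using True by (simp add: tendsto_eventually)
  next
    case False
    have "norm z = 1"
      using that D power_eq_1_iff[of z D] by auto
    thus ?thesis
      using False that by (auto intro!: euler_series_ratio_tendsto_0 \<delta> roots)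
  qed
  hence "((\<lambda>q. 1 / of_nat D * (\<Sum>z\<in>?U. ?G z q) - ?G 0 q)
      \<longlongrightarrow> 1 / of_nat D * (\<Sum>z\<in>?U. if z = 1 then 1 else 0) - 0) ?flt"
    using \<delta> by (intro tendsto_intros euler_series_ratio_tendsto_0) auto
  hence "((\<lambda>q. 1 / of_nat D * (\<Sum>z\<in>?U. ?G z q) - ?G 0 q) \<longlongrightarrow> 1 / of_nat D) ?flt"
    using fin by simp
  moreover have "\<forall>\<^sub>F q in ?flt. 1 / of_nat D * (\<Sum>z\<in>?U. ?G z q) - ?G 0 q = F {n. D dvd n} q"
    using ev by eventually_elim (simp add: F_multiples_eq D)
  ultimately show ?thesis by (rule Lim_transform_eventually)
qed

section \<open>Inclusion and exclusion over the primes\<close>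

lemma prod_prime_powers_dvd_iff:
  fixes n :: nat
  assumes "finite B" "\<And>p. p \<in> B \<Longrightarrow> prime p"
  shows "(\<Prod>p\<in>B. p ^ k) dvd n \<longleftrightarrow> (\<forall>p\<in>B. p ^ k dvd n)"
  using assms
proof (induction B rule: finite_induct)
  case (insert p B)
  have "coprime (p ^ k) (\<Prod>p\<in>B. p ^ k)"
  proof (rule prod_coprime_right)
    fix p' assume "p' \<in> B"
    hence "coprime p p'"
      using insert.hyps insert.prems by (intro primes_coprime) auto
    thus "coprime (p ^ k) (p' ^ k)" by simp
  qed
  hence "p ^ k * (\<Prod>p\<in>B. p ^ k) dvd n \<longleftrightarrow> p ^ k dvd n \<and> (\<Prod>p\<in>B. p ^ k) dvd n"
    by (metis divides_mult dvd_mult_left dvd_mult_right)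
  thus ?case using insert by simp
qed auto

text \<open>For n \<ge> 1 the indicator of the set is the product over the primes p of 1 minus the
  indicator of p^k dividing n; expanding it and using that \<open>F\<close> is linear in the
  indicator gives the sum.\<close>

lemma F_S_fr_eq:
  assumes q: "norm q < 1"
  shows "F (S_fr k N) q
       = (\<Sum>B\<in>Pow {p. prime p \<and> p \<le> N}. (-1) ^ card B * F {n. (\<Prod>p\<in>B. p ^ k) dvd n} q)"
proof -
  let ?P = "{p. prime p \<and> p \<le> N}"
  have fin: "finite ?P" by simp
  let ?e = "\<lambda>B n. if n \<in> {n. (\<Prod>p\<in>B. p ^ k) dvd n} \<and> n \<ge> 1 then euler_coeff q n else 0"
  have "summable (?e B)" for B
    by (rule summable_comparison_test[OF _ summable_norm_euler_coeff[OF q]]) auto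
  hence s: "summable (\<lambda>n. (-1) ^ card B * ?e B n)" "summable (?e B)" for B
    by (auto intro: summable_mult)
  have "(if n \<in> S_fr k N \<and> n \<ge> 1 then euler_coeff q n else 0)
      = (\<Sum>B\<in>Pow ?P. (-1) ^ card B * ?e B n)" for n
  proof (cases "n \<ge> 1")
    case True
    have "(if n \<in> S_fr k N then 1 else 0 :: complex)
        = (\<Prod>p\<in>?P. 1 - (if p ^ k dvd n then 1 else 0))"
      using True by (auto simp: S_fr_def prod_zero_iff intro!: prod.neutral[symmetric])
    also have "\<dots> = (\<Sum>B\<in>Pow ?P. (-1) ^ card B * (\<Prod>p\<in>B. if p ^ k dvd n then 1 else 0))"
      by (subst prod_diff_conv_sum[OF fin]) simp
    also have "\<dots> = (\<Sum>B\<in>Pow ?P. (-1) ^ card B * (if (\<Prod>p\<in>B. p ^ k) dvd n then 1 else 0))"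
    proof (intro sum.cong refl arg_cong[of _ _ "\<lambda>x. _ * x"])
      fix B assume B: "B \<in> Pow ?P"
      hence "finite B" using fin finite_subset by blast
      thus "(\<Prod>p\<in>B. if p ^ k dvd n then 1 else (0::complex)) = (if (\<Prod>p\<in>B. p ^ k) dvd n then 1 else 0)"
        using B by (subst prod_prime_powers_dvd_iff) (auto simp: prod_zero_iff intro!: prod.neutral)
    qed
    finally have "(if n \<in> S_fr k N then 1 else 0) * euler_coeff q n
        = (\<Sum>B\<in>Pow ?P. (-1) ^ card B * (if (\<Prod>p\<in>B. p ^ k) dvd n then 1 else 0) * euler_coeff q n)"
      by (simp add: sum_distrib_right)
    also have "\<dots> = (\<Sum>B\<in>Pow ?P. (-1) ^ card B * ?e B n)"
      using True by (intro sum.cong) auto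
    finally show ?thesis using True by (cases "n \<in> S_fr k N") simp_all
  qed auto
  hence "F (S_fr k N) q = (\<Sum>n. \<Sum>B\<in>Pow ?P. (-1) ^ card B * ?e B n) / euler_series q 1"
    unfolding F_eq_euler_sum[OF q] by simp
  also have "\<dots> = (\<Sum>B\<in>Pow ?P. (-1) ^ card B * (\<Sum>n. ?e B n)) / euler_series q 1"
    unfolding suminf_sum[OF s(1)] suminf_mult[OF s(2)] ..
  finally show ?thesis
    unfolding F_eq_euler_sum[OF q] by (simp add: sum_divide_distrib)
qed

lemma roots_of_unity_gap:
  assumes D: "D > 0"
  obtains \<delta> where "0 < \<delta>" "\<delta> \<le> 1" "\<And>z::complex. z ^ D = 1 \<Longrightarrow> z \<noteq> 1 \<Longrightarrow> \<delta> \<le> 1 - Re z"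
proof -
  \<comment> \<open>Inserting 0 makes V nonempty even for D = 1 and forces \<delta> \<le> 1.\<close>
  define V where "V = insert 0 ({z::complex. z ^ D = 1} - {1})"
  define \<delta> where "\<delta> = Min ((\<lambda>z. 1 - Re z) ` V)"
  have fin: "finite V" "V \<noteq> {}"
    unfolding V_def using D finite_roots_unity[of D, where ?'a = complex] by auto
  have pos: "1 - Re z > 0" if z: "z \<in> V" for z
  proof (rule ccontr)
    assume "\<not> 1 - Re z > 0"
    hence Re: "Re z \<ge> 1" "z \<noteq> 0" by auto
    with z have "z \<noteq> 1" "z ^ D = 1" by (auto simp: V_def)
    hence "norm z = 1"
      using D power_eq_1_iff[of z D] by auto
    moreover from this have "Re z = 1" using Re complex_Re_le_cmod[of z] by simp
    ultimately have "z = 1" by (simp add: complex_eq_iff cmod_def)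
    thus False using \<open>z \<noteq> 1\<close> by simp
  qed
  have le: "\<delta> \<le> 1 - Re z" if "z \<in> V" for z
    unfolding \<delta>_def using fin that by (intro Min_le) auto
  have "\<delta> > 0" unfolding \<delta>_def using fin pos by (subst Min_gr_iff) auto
  with le[of 0] le show ?thesis by (intro that[of \<delta>]) (auto simp: V_def)
qed

theorem theorem6p4:
  fixes k N :: nat
  assumes "k \<ge> 2" and "N \<ge> 2"
  shows "\<exists>K>1. (F (S_fr k N) \<longlongrightarrow> (\<Prod>p | prime p \<and> p \<le> N. 1 - 1 / of_nat p ^ k))
           (at 1 within stolz_region K)"
proof -
  let ?P = "{p. prime p \<and> p \<le> N}"
  have fin: "finite ?P" by simp
  define D where "D B = (\<Prod>p\<in>B. p ^ k)" for B :: "nat set"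
  have D_pos: "D B > 0" if "B \<subseteq> ?P" for B
    unfolding D_def using that by (intro prod_pos) (auto simp: prime_gt_0_nat)
  \<comment> \<open>Every \<open>D B\<close> divides \<open>D ?P\<close>, so the gap for the largest
    modulus works for all of them and fixes a single aperture.\<close>
  obtain \<delta> where \<delta>: "0 < \<delta>" "\<delta> \<le> 1"
      "\<And>z::complex. z ^ D ?P = 1 \<Longrightarrow> z \<noteq> 1 \<Longrightarrow> \<delta> \<le> 1 - Re z"
    using roots_of_unity_gap[OF D_pos[of ?P]] by auto
  define K where "K = sqrt (1 + (\<delta> / 128)\<^sup>2)"
  let ?flt = "at 1 within stolz_region K"
  have "K > 1" using \<delta> by (simp add: K_def)
  have multiples: "(F {n. D B dvd n} \<longlongrightarrow> 1 / of_nat (D B)) ?flt" if B: "B \<in> Pow ?P" for B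
    unfolding K_def
  proof (rule F_multiples_tendsto)
    fix z :: complex assume z: "z ^ D B = 1" "z \<noteq> 1"
    have "D B dvd D ?P"
      unfolding D_def using B fin by (intro prod_dvd_prod_subset) auto
    then obtain m where "D ?P = D B * m" by (rule dvdE)
    hence "z ^ D ?P = 1" using z by (simp add: power_mult)
    thus "\<delta> \<le> 1 - Re z" using \<delta> z by blast
  qed (use \<delta> D_pos B in auto)
  have "((\<lambda>q. \<Sum>B\<in>Pow ?P. (-1) ^ card B * F {n. D B dvd n} q)
      \<longlongrightarrow> (\<Sum>B\<in>Pow ?P. (-1) ^ card B * (1 / of_nat (D B)))) ?flt"
    by (intro tendsto_sum tendsto_mult tendsto_const multiples)
  moreover have "\<forall>\<^sub>F q in ?flt. (\<Sum>B\<in>Pow ?P. (-1) ^ card B * F {n. D B dvd n} q) = F (S_fr k N) q"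
    unfolding eventually_at by (auto intro!: exI[of _ 1] simp: stolz_region_def F_S_fr_eq D_def)
  ultimately have "(F (S_fr k N) \<longlongrightarrow> (\<Sum>B\<in>Pow ?P. (-1) ^ card B * (1 / of_nat (D B)))) ?flt"
    by (rule Lim_transform_eventually)
  \<comment> \<open>The same subset expansion read backwards, as 1 / \<open>D B\<close> is the
    product of the 1/p^k.\<close>
  also have "(\<Sum>B\<in>Pow ?P. (-1) ^ card B * (1 / of_nat (D B)))
      = (\<Prod>p\<in>?P. 1 - 1 / of_nat p ^ k :: complex)"
    by (subst prod_diff_conv_sum[OF fin]) (simp add: D_def prod_dividef)
  finally show ?thesis using \<open>K > 1\<close> by blast
qed

end
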